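(* $\mathcal{EM}\cap\mathrm{Perf}=\mathfrak{P}_2\cap\mathrm{Perf}$.
   Context: $2^\omega$ is the Cantor space, $[\omega]^\omega$ is the family of infinite subsets of $\omega$, and $\mathrm{Perf}$ is the class of all perfect subsets of $2^\omega$ (closed sets without isolated points). For $S\in[\omega]^\omega$, $2^S$ carries the product topology. For $X\subseteq 2^\omega$, $X\restriction S=\{x\restriction S:x\in X\}\subseteq 2^S$. Define $\mathcal{EM}=\{X\subseteq 2^\omega:(\forall S\in[\omega]^\omega)\ X\restriction S\text{ is meager in }2^S\}$ and $\mathfrak{P}_2=\{X\subseteq 2^\omega:(\forall S\in[\omega]^\omega)\ X\restriction S\neq 2^S\}$. *)

theory Defs
  imports "HOL-Analysis.Analysis"
begin

text \<open>The space \<open>2\<^sup>S\<close> for a set \<open>S\<close> of natural numbers, with \<open>2\<close> rendered as the discrete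
  type \<^typ>\<open>bool\<close>. Its points are the functions on \<open>\<nat>\<close> that are \<^const>\<open>undefined\<close> outside \<open>S\<close>;
  for \<open>S = UNIV\<close> this is the Cantor space on the whole type \<^typ>\<open>nat \<Rightarrow> bool\<close>.\<close>

definition two_pow :: "nat set \<Rightarrow> (nat \<Rightarrow> bool) topology" where
  "two_pow S = product_topology (\<lambda>_. discrete_topology UNIV) S"

abbreviation Cantor_space :: "(nat \<Rightarrow> bool) topology" where
  "Cantor_space \<equiv> two_pow UNIV"

definition restr :: "(nat \<Rightarrow> bool) set \<Rightarrow> nat set \<Rightarrow> (nat \<Rightarrow> bool) set" where
  "restr X S = (\<lambda>x. restrict x S) ` X"

definition nowhere_dense_in :: "'a topology \<Rightarrow> 'a set \<Rightarrow> bool" where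
  "nowhere_dense_in T A \<longleftrightarrow> A \<subseteq> topspace T \<and> T interior_of (T closure_of A) = {}"

definition meager_in :: "'a topology \<Rightarrow> 'a set \<Rightarrow> bool" where
  "meager_in T A \<longleftrightarrow> (\<exists>\<N>. countable \<N> \<and> (\<forall>N\<in>\<N>. nowhere_dense_in T N) \<and> A = \<Union>\<N>)"

text \<open>Closed sets all of whose points are accumulation points, i.e. without isolated points;
  the empty set is included.\<close>

definition Perf :: "(nat \<Rightarrow> bool) set set" where
  "Perf = {P. closedin Cantor_space P \<and> P \<subseteq> Cantor_space derived_set_of P}"

definition EM :: "(nat \<Rightarrow> bool) set set" where
  "EM = {X. X \<subseteq> topspace Cantor_space \<and> (\<forall>S. infinite S \<longrightarrow> meager_in (two_pow S) (restr X S))}"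

definition P2 :: "(nat \<Rightarrow> bool) set set" where
  "P2 = {X. X \<subseteq> topspace Cantor_space \<and> (\<forall>S. infinite S \<longrightarrow> restr X S \<noteq> topspace (two_pow S))}"

end

theory Submission
  imports Defs
begin

text \<open>
  One inclusion is the Baire category theorem: the compact Hausdorff space \<open>2\<^sup>S\<close> is not meager in
  itself (\<open>two_pow_not_meager\<close>), so a set all of whose restrictions are meager has no restriction
  onto the whole of \<open>2\<^sup>S\<close>.

  For the other inclusion, let \<open>P\<close> be closed in the Cantor space. Restriction to \<open>S\<close> is continuous,
  so by compactness \<open>P\<restriction>S\<close> is closed in \<open>2\<^sup>S\<close> (\<open>closedin_restr\<close>); hence if it is not meager, it is
  not even nowhere dense and contains a nonempty basic open set. Such a set constrains only
  finitely many coordinates; after discarding them, an infinite \<open>S' \<subseteq> S\<close> remains on which the basic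
  set, and so \<open>P\<close>, realises every function (\<open>restr_full_of_interior\<close>). So \<open>P\<close> is not in \<open>P2\<close>.
\<close>

lemma topspace_two_pow: "topspace (two_pow S) = (\<Pi>\<^sub>E i\<in>S. UNIV)"
  by (simp add: two_pow_def)

lemma compact_space_two_pow: "compact_space (two_pow S)"
  by (simp add: two_pow_def compact_space_product_topology compact_space_discrete_topology)

lemma Hausdorff_space_two_pow: "Hausdorff_space (two_pow S)"
  by (simp add: two_pow_def Hausdorff_space_product_topology)

lemma restr_subset_topspace: "restr X S \<subseteq> topspace (two_pow S)"
  by (auto simp: restr_def topspace_two_pow)

lemma two_pow_not_meager: "\<not> meager_in (two_pow S) (topspace (two_pow S))"
proof
  let ?T = "two_pow S"
  assume "meager_in ?T (topspace ?T)"
  then obtain \<N> where \<N>: "countable \<N>" "\<And>N. N \<in> \<N> \<Longrightarrow> nowhere_dense_in ?T N"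
    and cover: "topspace ?T = \<Union>\<N>"
    by (auto simp: meager_in_def)
  have "?T interior_of \<Union>((closure_of) ?T ` \<N>) = {}"
  proof (rule Baire_category_alt)
    show "completely_metrizable_space ?T \<or> locally_compact_space ?T \<and> regular_space ?T"
      by (simp add: compact_Hausdorff_imp_regular_space compact_imp_locally_compact_space
          compact_space_two_pow Hausdorff_space_two_pow)
  qed (use \<N> in \<open>auto simp: nowhere_dense_in_def\<close>)
  moreover have "\<Union>((closure_of) ?T ` \<N>) = topspace ?T"
  proof
    show "\<Union>((closure_of) ?T ` \<N>) \<subseteq> topspace ?T"
      by (simp add: UN_least closure_of_subset_topspace)
    have "N \<subseteq> ?T closure_of N" if "N \<in> \<N>" for N
      using \<N>(2)[OF that] by (simp add: nowhere_dense_in_def closure_of_subset)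
    then show "topspace ?T \<subseteq> \<Union>((closure_of) ?T ` \<N>)"
      unfolding cover by blast
  qed
  ultimately have "topspace ?T = {}"
    by simp
  then show False
    by (simp add: topspace_two_pow PiE_eq_empty_iff)
qed

lemma closedin_restr:
  assumes "closedin Cantor_space P"
  shows "closedin (two_pow S) (restr P S)"
proof -
  have "continuous_map Cantor_space (two_pow S) (\<lambda>x. restrict x S)"
    unfolding two_pow_def by (rule continuous_on_restrict) simp
  then have "compactin (two_pow S) (restr P S)"
    unfolding restr_def
    using image_compactin closedin_compact_space[OF compact_space_two_pow assms] by blast
  then show ?thesis
    by (rule compactin_imp_closedin[OF Hausdorff_space_two_pow])
qed

text \<open>A basic open box leaves all but finitely many coordinates unconstrained, so on those
  coordinates its points realise every function; the remaining coordinates are filled in with the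
  values of a fixed point of the box.\<close>

lemma restr_full_of_interior:
  assumes "two_pow S interior_of restr X S \<noteq> {}"
  obtains S' where "S' \<subseteq> S" "finite (S - S')" "restr X S' = topspace (two_pow S')"
proof -
  obtain x where "x \<in> two_pow S interior_of restr X S"
    using assms by blast
  then obtain B where x: "x \<in> Pi\<^sub>E S B" and fin: "finite {i. B i \<noteq> UNIV}"
    and sub: "Pi\<^sub>E S B \<subseteq> restr X S"
    using product_topology_open_contains_basis[of "\<lambda>_. discrete_topology UNIV" S
        "two_pow S interior_of restr X S" x] interior_of_subset[of "two_pow S" "restr X S"]
    by (force simp: two_pow_def)
  define S' where "S' = {i \<in> S. B i = UNIV}"
  have "y \<in> restr X S'" if y: "y \<in> topspace (two_pow S')" for y
  proof -
    define z where "z = (\<lambda>i. if i \<in> S' then y i else x i)"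
    have "z \<in> Pi\<^sub>E S B"
      using x by (auto simp: z_def S'_def PiE_iff extensional_def)
    then obtain w where w: "w \<in> X" "z = restrict w S"
      using sub by (auto simp: restr_def)
    have "y i = restrict w S' i" for i
    proof (cases "i \<in> S'")
      case True
      then have "y i = z i" "i \<in> S"
        by (auto simp: z_def S'_def)
      with True w show ?thesis
        by simp
    next
      case False
      with y show ?thesis
        by (auto simp: topspace_two_pow PiE_iff extensional_def)
    qed
    then have "y = restrict w S'"
      by (rule ext)
    then show ?thesis
      using w(1) by (simp add: restr_def)
  qed
  then have "restr X S' = topspace (two_pow S')"
    using restr_subset_topspace by blast
  moreover have "finite (S - S')"
    by (rule finite_subset[OF _ fin]) (auto simp: S'_def)
  ultimately show ?thesis
    using that[of S'] by (auto simp: S'_def)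
qed

lemma EM_subset_P2: "EM \<subseteq> P2"
  unfolding EM_def P2_def using two_pow_not_meager by force

lemma closed_P2_imp_EM:
  assumes "P \<in> P2" and closed: "closedin Cantor_space P"
  shows "P \<in> EM"
proof -
  have "meager_in (two_pow S) (restr P S)" if inf: "infinite S" for S
  proof -
    have "two_pow S interior_of restr P S = {}"
    proof (rule ccontr)
      assume "two_pow S interior_of restr P S \<noteq> {}"
      then obtain S' where "S' \<subseteq> S" "finite (S - S')" "restr P S' = topspace (two_pow S')"
        by (rule restr_full_of_interior)
      moreover from this inf have "infinite S'"
        using finite_Diff2 by blast
      ultimately show False
        using assms(1) by (auto simp: P2_def)
    qed
    then have "nowhere_dense_in (two_pow S) (restr P S)"
      by (simp add: nowhere_dense_in_def restr_subset_topspace closure_of_closedin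
          closedin_restr[OF closed])
    then show ?thesis
      unfolding meager_in_def by (intro exI[of _ "{restr P S}"]) simp
  qed
  then show ?thesis
    using assms(1) by (auto simp: EM_def P2_def)
qed

theorem theorem3p2:
  shows "EM \<inter> Perf = P2 \<inter> Perf"
  using EM_subset_P2 closed_P2_imp_EM by (auto simp: Perf_def)

end
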